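(* Let $F_1$ and $F_2$ be finite subsets of $\mathbb{Z}^2$ such that $F_1$ is uniquely determined by its row and column sums and $|F_1| = |F_2|$. Let $2\alpha = \sum_{j\in\mathbb{Z}} |c_j^{(1)} - c_j^{(2)}| + \sum_{i\in\mathbb{Z}} |r_i^{(1)} - r_i^{(2)}|$ and $p = |F_1 \cap F_2|$. Then \[ |F_1| \le \sum_{i=1}^{\alpha+p} \left\lfloor \frac{\alpha+p}{i} \right\rfloor. \]
   Context: For $i \in \mathbb{Z}$, row $i$ is $\{(x,y)\in\mathbb{Z}^2 : x = i\}$ and for $j\in\mathbb{Z}$, column $j$ is $\{(x,y)\in\mathbb{Z}^2: y=j\}$. For $h\in\{1,2\}$, $r_i^{(h)}$ is the number of points of $F_h$ in row $i$ and $c_j^{(h)}$ the number of points of $F_h$ in column $j$. $F_1$ is uniquely determined by its row and column sums if no finite subset of $\mathbb{Z}^2$ other than $F_1$ has the same row sums and column sums. The total error in the line sums is always even, hence written $2\alpha$ with $\alpha$ a nonnegative integer. *)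

theory Defs
  imports Complex_Main "HOL-Library.Groups_Big_Fun"
begin

(* Matrix-style convention: the first coordinate is the row index. *)

definition row :: "int \<Rightarrow> (int \<times> int) set" where
  "row i = {(x, y). x = i}"

definition column :: "int \<Rightarrow> (int \<times> int) set" where
  "column j = {(x, y). y = j}"

definition row_sum :: "(int \<times> int) set \<Rightarrow> int \<Rightarrow> nat" where
  "row_sum F i = card (F \<inter> row i)"

definition column_sum :: "(int \<times> int) set \<Rightarrow> int \<Rightarrow> nat" where
  "column_sum F j = card (F \<inter> column j)"

definition uniquely_determined :: "(int \<times> int) set \<Rightarrow> bool" where
  "uniquely_determined F \<longleftrightarrow>
    (\<forall>G. finite G \<and> (\<forall>i. row_sum G i = row_sum F i) \<and> (\<forall>j. column_sum G j = column_sum F j)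
      \<longrightarrow> G = F)"

(* Sum_any is the sum over all of int of a function with finite support (and 0 if the support is
   infinite; for finite sets F1 and F2 the supports are finite, as shown below). *)

definition line_sum_error :: "(int \<times> int) set \<Rightarrow> (int \<times> int) set \<Rightarrow> int" where
  "line_sum_error F1 F2 =
    Sum_any (\<lambda>j. \<bar>int (column_sum F1 j) - int (column_sum F2 j)\<bar>) +
    Sum_any (\<lambda>i. \<bar>int (row_sum F1 i) - int (row_sum F2 i)\<bar>)"

lemma finite_support_row_sum_diff:
  assumes "finite F1" "finite F2"
  shows "finite {i. \<bar>int (row_sum F1 i) - int (row_sum F2 i)\<bar> \<noteq> 0}"
proof (rule finite_subset)
  show "{i. \<bar>int (row_sum F1 i) - int (row_sum F2 i)\<bar> \<noteq> 0} \<subseteq> fst ` (F1 \<union> F2)"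
  proof
    fix i assume "i \<in> {i. \<bar>int (row_sum F1 i) - int (row_sum F2 i)\<bar> \<noteq> 0}"
    then have "F1 \<inter> row i \<noteq> {} \<or> F2 \<inter> row i \<noteq> {}"
      by (auto simp: row_sum_def)
    then show "i \<in> fst ` (F1 \<union> F2)"
      by (force simp: row_def)
  qed
qed (use assms in simp)

lemma finite_support_column_sum_diff:
  assumes "finite F1" "finite F2"
  shows "finite {j. \<bar>int (column_sum F1 j) - int (column_sum F2 j)\<bar> \<noteq> 0}"
proof (rule finite_subset)
  show "{j. \<bar>int (column_sum F1 j) - int (column_sum F2 j)\<bar> \<noteq> 0} \<subseteq> snd ` (F1 \<union> F2)"
  proof
    fix j assume "j \<in> {j. \<bar>int (column_sum F1 j) - int (column_sum F2 j)\<bar> \<noteq> 0}"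
    then have "F1 \<inter> column j \<noteq> {} \<or> F2 \<inter> column j \<noteq> {}"
      by (auto simp: column_sum_def)
    then show "j \<in> snd ` (F1 \<union> F2)"
      by (force simp: column_def)
  qed
qed (use assms in simp)

end

theory Submission
  imports Defs
begin

text \<open>
  Uniqueness forbids switching components, so the rows of \<open>F1\<close>, as sets of columns, form a chain.
  Fix a nonempty row \<open>B\<close> of \<open>F1\<close> and let \<open>A\<close> be the set of rows containing it. Then
  \<open>A \<times> B \<subseteq> F1\<close>, and \<open>F1\<close> lies in the union of the lines through \<open>A\<close> and \<open>B\<close>. Adding up the
  line sums over \<open>A\<close> and \<open>B\<close> gives \<open>|F1| + |A| |B|\<close> for \<open>F1\<close> and at most \<open>|F2| + p\<close>
  for \<open>F2\<close>; since \<open>|F1| = |F2|\<close>, these differ by at most \<open>\<alpha>\<close>, so \<open>|A| |B| \<le> \<alpha> + p\<close>.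
  Hence at most \<open>(\<alpha> + p) / j\<close> rows have at least \<open>j\<close> points; sum over \<open>j\<close>.
\<close>

lemma mem_row_iff [simp]: "(x, y) \<in> row i \<longleftrightarrow> x = i"
  by (simp add: row_def)

lemma mem_column_iff [simp]: "(x, y) \<in> column j \<longleftrightarrow> y = j"
  by (simp add: column_def)

text \<open>The four points are the corners of a rectangle with only one diagonal in
  \<open>F\<close>. Trading that diagonal for the other replaces one point by another on each of the
  four lines involved, so no line sum changes.\<close>

lemma switch_not_uniquely_determined:
  assumes fin: "finite F"
    and xy: "(x, y) \<in> F" "(x', y') \<in> F" "(x, y') \<notin> F" "(x', y) \<notin> F"
  shows "\<not> uniquely_determined F"
proof -
  define G where "G = insert (x, y') (insert (x', y) (F - {(x, y), (x', y')}))"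
  have ne: "x \<noteq> x'" "y \<noteq> y'"
    using xy by auto
  have exchange: "card (insert b (S - {a})) = card S" if "finite S" "a \<in> S" "b \<notin> S"
    for a b :: "int \<times> int" and S
    using that by (metis Diff_iff card_Suc_Diff1 card_insert_disjoint finite_Diff)
  have "row_sum G i = row_sum F i" for i
  proof -
    consider "i = x" | "i = x'" | "i \<noteq> x" "i \<noteq> x'" by blast
    then show ?thesis
    proof cases
      case 1
      then have "G \<inter> row i = insert (x, y') (F \<inter> row i - {(x, y)})"
        using ne by (auto simp: G_def)
      with 1 show ?thesis
        unfolding row_sum_def using exchange[of "F \<inter> row i" "(x, y)" "(x, y')"] fin xy by simp
    next
      case 2
      then have "G \<inter> row i = insert (x', y) (F \<inter> row i - {(x', y')})"
        using ne by (auto simp: G_def)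
      with 2 show ?thesis
        unfolding row_sum_def using exchange[of "F \<inter> row i" "(x', y')" "(x', y)"] fin xy by simp
    next
      case 3
      then have "G \<inter> row i = F \<inter> row i"
        by (auto simp: G_def)
      then show ?thesis by (simp add: row_sum_def)
    qed
  qed
  moreover have "column_sum G j = column_sum F j" for j
  proof -
    consider "j = y" | "j = y'" | "j \<noteq> y" "j \<noteq> y'" by blast
    then show ?thesis
    proof cases
      case 1
      then have "G \<inter> column j = insert (x', y) (F \<inter> column j - {(x, y)})"
        using ne by (auto simp: G_def)
      with 1 show ?thesis
        unfolding column_sum_def using exchange[of "F \<inter> column j" "(x, y)" "(x', y)"] fin xy by simp
    next
      case 2
      then have "G \<inter> column j = insert (x, y') (F \<inter> column j - {(x', y')})"
        using ne by (auto simp: G_def)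
      with 2 show ?thesis
        unfolding column_sum_def using exchange[of "F \<inter> column j" "(x', y')" "(x, y')"] fin xy by simp
    next
      case 3
      then have "G \<inter> column j = F \<inter> column j"
        by (auto simp: G_def)
      then show ?thesis by (simp add: column_sum_def)
    qed
  qed
  moreover have "finite G" "G \<noteq> F"
    using fin xy by (auto simp: G_def)
  ultimately show ?thesis
    unfolding uniquely_determined_def by blast
qed

text \<open>If neither row contained the other, a column from each difference would give a
  switchable rectangle.\<close>

lemma uniquely_determined_rows_chain:
  assumes "finite F" "uniquely_determined F"
  shows "F `` {x} \<subseteq> F `` {x'} \<or> F `` {x'} \<subseteq> F `` {x}"
  using switch_not_uniquely_determined[OF assms(1)] assms(2) by blast

lemma row_sum_eq_card_Image:
  "row_sum F x = card (F `` {x})"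
proof -
  have "F \<inter> row x = Pair x ` (F `` {x})"
    by auto
  then show ?thesis
    by (simp add: row_sum_def card_image inj_on_def)
qed

lemma sum_row_sum:
  assumes "finite F" "finite A"
  shows "(\<Sum>i\<in>A. row_sum F i) = card (F \<inter> A \<times> UNIV)"
proof -
  have "F \<inter> A \<times> UNIV = (\<Union>i\<in>A. F \<inter> row i)"
    by auto
  also have "card \<dots> = (\<Sum>i\<in>A. row_sum F i)"
    unfolding row_sum_def using assms by (intro card_UN_disjoint) auto
  finally show ?thesis by simp
qed

lemma sum_column_sum:
  assumes "finite F" "finite B"
  shows "(\<Sum>j\<in>B. column_sum F j) = card (F \<inter> UNIV \<times> B)"
proof -
  have "F \<inter> UNIV \<times> B = (\<Union>j\<in>B. F \<inter> column j)"
    by auto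
  also have "card \<dots> = (\<Sum>j\<in>B. column_sum F j)"
    unfolding column_sum_def using assms by (intro card_UN_disjoint) auto
  finally show ?thesis by simp
qed

text \<open>As the total is zero, the sum over \<open>A\<close> is also minus the sum over
  \<open>I - A\<close>. Bounding both expressions by absolute values and adding gives the factor
  2.\<close>

lemma twice_partial_sum_le_sum_abs:
  fixes d :: "'a \<Rightarrow> int"
  assumes "finite I" "A \<subseteq> I" "sum d I = 0"
  shows "2 * sum d A \<le> (\<Sum>i\<in>I. \<bar>d i\<bar>)"
proof -
  have split: "sum g I = sum g (I - A) + sum g A" for g :: "'a \<Rightarrow> int"
    using assms by (intro sum.subset_diff) auto
  have "sum d A \<le> (\<Sum>i\<in>A. \<bar>d i\<bar>)" "- sum d (I - A) \<le> (\<Sum>i\<in>I - A. \<bar>d i\<bar>)"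
    by (auto intro!: sum_mono simp flip: sum_negf)
  with split[of d] split[of "\<lambda>i. \<bar>d i\<bar>"] assms(3) show ?thesis
    by simp
qed

lemma line_sums_diff_le_error:
  assumes fin: "finite F1" "finite F2"
    and card: "card F1 = card F2"
    and A: "A \<subseteq> fst ` F1" and B: "B \<subseteq> snd ` F1"
  shows "2 * ((\<Sum>i\<in>A. int (row_sum F1 i) - int (row_sum F2 i)) +
              (\<Sum>j\<in>B. int (column_sum F1 j) - int (column_sum F2 j))) \<le> line_sum_error F1 F2"
proof -
  \<comment> \<open>\<open>I\<close> and \<open>J\<close> are finite windows meeting every point of
    both sets: over them \<open>Sum_any\<close> becomes a finite sum, and the deviations add up to
    \<open>card F1 - card F2\<close>, which is zero.\<close>
  define I where "I = fst ` (F1 \<union> F2)"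
  define J where "J = snd ` (F1 \<union> F2)"
  define r where "r i = int (row_sum F1 i) - int (row_sum F2 i)" for i
  define c where "c j = int (column_sum F1 j) - int (column_sum F2 j)" for j
  have finIJ: "finite I" "finite J"
    using fin by (auto simp: I_def J_def)
  have I: "F1 \<inter> I \<times> UNIV = F1" "F2 \<inter> I \<times> UNIV = F2"
    and J: "F1 \<inter> UNIV \<times> J = F1" "F2 \<inter> UNIV \<times> J = F2"
    by (force simp: I_def J_def)+
  have "sum r I = 0"
    unfolding r_def using fin finIJ card I
    by (simp add: sum_subtractf sum_row_sum flip: of_nat_sum)
  then have "2 * sum r A \<le> (\<Sum>i\<in>I. \<bar>r i\<bar>)"
    using A finIJ by (intro twice_partial_sum_le_sum_abs) (auto simp: I_def)
  moreover have "sum c J = 0"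
    unfolding c_def using fin finIJ card J
    by (simp add: sum_subtractf sum_column_sum flip: of_nat_sum)
  then have "2 * sum c B \<le> (\<Sum>j\<in>J. \<bar>c j\<bar>)"
    using B finIJ by (intro twice_partial_sum_le_sum_abs) (auto simp: J_def)
  moreover have "{i. \<bar>r i\<bar> \<noteq> 0} \<subseteq> I"
  proof
    fix i assume "i \<in> {i. \<bar>r i\<bar> \<noteq> 0}"
    then have "F1 \<inter> row i \<noteq> {} \<or> F2 \<inter> row i \<noteq> {}"
      by (auto simp: r_def row_sum_def)
    then show "i \<in> I"
      by (force simp: I_def)
  qed
  then have "Sum_any (\<lambda>i. \<bar>r i\<bar>) = (\<Sum>i\<in>I. \<bar>r i\<bar>)"
    by (rule Sum_any.expand_superset[OF finIJ(1)])
  moreover have "{j. \<bar>c j\<bar> \<noteq> 0} \<subseteq> J"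
  proof
    fix j assume "j \<in> {j. \<bar>c j\<bar> \<noteq> 0}"
    then have "F1 \<inter> column j \<noteq> {} \<or> F2 \<inter> column j \<noteq> {}"
      by (auto simp: c_def column_sum_def)
    then show "j \<in> J"
      by (force simp: J_def)
  qed
  then have "Sum_any (\<lambda>j. \<bar>c j\<bar>) = (\<Sum>j\<in>J. \<bar>c j\<bar>)"
    by (rule Sum_any.expand_superset[OF finIJ(2)])
  ultimately show ?thesis
    unfolding line_sum_error_def r_def c_def by simp
qed

lemma card_rectangle_le:
  assumes fin: "finite F1" "finite F2"
    and card: "card F1 = card F2"
    and error: "2 * int \<alpha> = line_sum_error F1 F2"
    and A: "A \<subseteq> fst ` F1" and B: "B \<subseteq> snd ` F1"
    and rect: "A \<times> B \<subseteq> F1" and cover: "F1 \<subseteq> A \<times> UNIV \<union> UNIV \<times> B"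
  shows "card A * card B \<le> \<alpha> + card (F1 \<inter> F2)"
proof -
  have finAB: "finite A" "finite B"
    using A B fin by (auto intro: finite_subset)
  \<comment> \<open>Inclusion-exclusion: the points of \<open>A \<times> B\<close> lie on a chosen
    row and a chosen column, so they are counted twice.\<close>
  have line_sums: "(\<Sum>i\<in>A. row_sum F i) + (\<Sum>j\<in>B. column_sum F j)
      = card (F \<inter> (A \<times> UNIV \<union> UNIV \<times> B)) + card (F \<inter> A \<times> B)" if "finite F" for F
  proof -
    have "(F \<inter> A \<times> UNIV) \<inter> (F \<inter> UNIV \<times> B) = F \<inter> A \<times> B"
      by auto
    then show ?thesis
      using that finAB card_Un_Int[of "F \<inter> A \<times> UNIV" "F \<inter> UNIV \<times> B"]
      by (simp add: sum_row_sum sum_column_sum Int_Un_distrib)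
  qed
  have "(\<Sum>i\<in>A. row_sum F1 i) + (\<Sum>j\<in>B. column_sum F1 j) = card F1 + card A * card B"
    using line_sums[OF fin(1)] rect cover
    by (simp add: Int_absorb1 Int_absorb2 card_cartesian_product)
  \<comment> \<open>Since the rectangle lies in \<open>F1\<close>, the points of \<open>F2\<close>
    counted twice all belong to \<open>F1 \<inter> F2\<close>.\<close>
  moreover have "(\<Sum>i\<in>A. row_sum F2 i) + (\<Sum>j\<in>B. column_sum F2 j) \<le> card F2 + card (F1 \<inter> F2)"
    unfolding line_sums[OF fin(2)] using fin rect by (intro add_mono card_mono) auto
  moreover have "2 * ((\<Sum>i\<in>A. int (row_sum F1 i) - int (row_sum F2 i)) +
      (\<Sum>j\<in>B. int (column_sum F1 j) - int (column_sum F2 j))) \<le> 2 * int \<alpha>"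
    unfolding error by (rule line_sums_diff_le_error[OF fin card A B])
  then have "(\<Sum>i\<in>A. row_sum F1 i) + (\<Sum>j\<in>B. column_sum F1 j)
      \<le> (\<Sum>i\<in>A. row_sum F2 i) + (\<Sum>j\<in>B. column_sum F2 j) + \<alpha>"
    by (simp add: sum_subtractf flip: of_nat_sum)
  ultimately show ?thesis
    using card by linarith
qed

lemma card_long_rows_le:
  assumes fin: "finite F1" "finite F2"
    and uniq: "uniquely_determined F1"
    and card: "card F1 = card F2"
    and error: "2 * int \<alpha> = line_sum_error F1 F2"
  shows "card {x \<in> fst ` F1. j \<le> row_sum F1 x} * j \<le> \<alpha> + card (F1 \<inter> F2)"
proof (cases "{x \<in> fst ` F1. j \<le> row_sum F1 x} = {}")
  case True
  then show ?thesis by (simp only: card.empty mult_0 zero_le)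
next
  case False
  define S where "S = {x \<in> fst ` F1. j \<le> row_sum F1 x}"
  have "finite S" "S \<noteq> {}"
    using fin False by (auto simp: S_def)
  \<comment> \<open>A shortest row in \<open>S\<close> is contained in every row of
    \<open>S\<close>: by the chain property a row of \<open>S\<close> not containing it would be a
    proper subset, hence shorter.\<close>
  then obtain x where x: "x \<in> S" and min: "\<And>x'. x' \<in> S \<Longrightarrow> row_sum F1 x \<le> row_sum F1 x'"
    using arg_min_if_finite[of S "row_sum F1"] by (metis leI)
  define A where "A = {x' \<in> fst ` F1. F1 `` {x} \<subseteq> F1 `` {x'}}"
  define B where "B = F1 `` {x}"
  have chain: "F1 `` {x} \<subseteq> F1 `` {x'} \<or> F1 `` {x'} \<subseteq> F1 `` {x}" for x'
    by (rule uniquely_determined_rows_chain[OF fin(1) uniq])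
  have finB: "finite (F1 `` {x'})" for x'
    using fin by (intro finite_Image) auto
  have "S \<subseteq> A"
  proof
    fix x' assume x': "x' \<in> S"
    have "card (F1 `` {x}) \<le> card (F1 `` {x'})"
      using min[OF x'] by (simp add: row_sum_eq_card_Image)
    then have "F1 `` {x} \<subseteq> F1 `` {x'}"
      using chain[of x'] finB by (metis card_seteq order_refl)
    then show "x' \<in> A"
      using x' by (simp add: A_def S_def)
  qed
  moreover have "finite A"
    using fin by (simp add: A_def)
  moreover have "j \<le> card B"
    using x by (simp add: S_def B_def row_sum_eq_card_Image)
  ultimately have "card S * j \<le> card A * card B"
    by (intro mult_le_mono card_mono)
  also have "\<dots> \<le> \<alpha> + card (F1 \<inter> F2)"
  proof (rule card_rectangle_le[OF fin card error])
    show "B \<subseteq> snd ` F1"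
      by (force simp: B_def)
    \<comment> \<open>By the chain property, a row outside \<open>A\<close> is contained in
      \<open>B\<close>, so its points lie in the columns of \<open>B\<close>.\<close>
    show "F1 \<subseteq> A \<times> UNIV \<union> UNIV \<times> B"
      using chain by (force simp: A_def B_def)
  qed (auto simp: A_def B_def)
  finally show ?thesis
    by (simp add: S_def)
qed

text \<open>Double counting: write \<open>f x\<close> as the number of positive
  \<open>j \<le> f x\<close> and exchange the sums, as in passing to the conjugate partition. Each
  \<open>j\<close> then contributes at most \<open>N div j\<close>.\<close>

lemma sum_le_sum_div:
  fixes f :: "'a \<Rightarrow> nat"
  assumes "finite X" and count: "\<And>j. card {x \<in> X. j \<le> f x} * j \<le> N"
  shows "sum f X \<le> (\<Sum>j = 1..N. N div j)"
proof -
  \<comment> \<open>Taking \<open>j = f x\<close> in \<open>count\<close>, where \<open>x\<close>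
    itself is counted, shows that stopping at \<open>j = N\<close> loses nothing.\<close>
  have le: "f x \<le> N" if "x \<in> X" for x
  proof -
    have "0 < card {y \<in> X. f x \<le> f y}"
      using that assms(1) by (auto simp: card_gt_0_iff)
    then show ?thesis
      using count[of "f x"] by (metis Suc_leI mult_le_mono1 nat_mult_1 One_nat_def le_trans)
  qed
  have "sum f X = (\<Sum>x\<in>X. \<Sum>j = 1..N. if j \<le> f x then 1 else 0)"
  proof (rule sum.cong[OF refl])
    fix x assume "x \<in> X"
    then have "{1..N} \<inter> {j. j \<le> f x} = {1..f x}"
      using le by fastforce
    then show "f x = (\<Sum>j = 1..N. if j \<le> f x then 1 else 0)"
      by (simp add: sum.If_cases)
  qed
  also have "\<dots> = (\<Sum>j = 1..N. card {x \<in> X. j \<le> f x})"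
    using assms(1) by (subst sum.swap) (simp add: sum.If_cases Int_def)
  also have "\<dots> \<le> (\<Sum>j = 1..N. N div j)"
    using count by (intro sum_mono) (simp add: less_eq_div_iff_mult_less_eq)
  finally show ?thesis .
qed

theorem theorem7:
  fixes F1 F2 :: "(int \<times> int) set" and \<alpha> p :: nat
  assumes "finite F1" and "finite F2"
    and "uniquely_determined F1"
    and "card F1 = card F2"
    and "2 * int \<alpha> = line_sum_error F1 F2"
    and "p = card (F1 \<inter> F2)"
  shows "int (card F1) \<le> (\<Sum>i = 1..\<alpha> + p. \<lfloor>real (\<alpha> + p) / real i\<rfloor>)"
proof -
  have "F1 \<inter> fst ` F1 \<times> UNIV = F1"
    by force
  then have "card F1 = (\<Sum>i\<in>fst ` F1. row_sum F1 i)"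
    using assms(1) by (simp add: sum_row_sum)
  \<comment> \<open>Here \<open>X\<close> is the set of nonempty rows of \<open>F1\<close>,
    \<open>f\<close> is \<open>row_sum F1\<close> and \<open>N\<close> is
    \<open>\<alpha> + p\<close>.\<close>
  also have "\<dots> \<le> (\<Sum>i = 1..\<alpha> + p. (\<alpha> + p) div i)"
    using assms card_long_rows_le by (intro sum_le_sum_div) auto
  finally have "int (card F1) \<le> int (\<Sum>i = 1..\<alpha> + p. (\<alpha> + p) div i)"
    by (rule of_nat_mono)
  then show ?thesis
    by (simp only: of_nat_sum floor_divide_of_nat_eq)
qed

end
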